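(* Let $M>0$ be a constant and let $F$ be a stochastic process on $[-M,M]$ with continuous sample paths. Let $I\subset[0,M]$ be a nonempty compact set and let $J\subset[-M,0)$ be nonempty. Then, for every $t\in\mathbb R$, the following two events are equal: $$\left\{\inf_{u\in I}\ \sup_{v\in J}\frac{F(u)-F(v)}{u-v}\le t\right\}=\left\{\inf_{u\in I}\ \sup_{v\in J}\bigl[F(u)-F(v)-t(u-v)\bigr]\le0\right\}.$$ In particular, the two events have the same probability.
   Context: Infima and suprema are taken in the extended real line. *)

theory Defs
  imports "HOL-Probability.Probability"
begin

end

(* Every difference quotient and every difference is continuous in u on the compact set I, so the
   supremum over v is lower semicontinuous in u and its infimum over I is attained. Hence either
   event says that some u in I satisfies the bound for all v in J simultaneously; as u - v > 0, the
   two bounds are equivalent pointwise. With g u = F u - t u the common event reads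
   "g u \<le> g v for some u in I and all v in J", and since g attains its minimum on I, the quantifiers
   may be exchanged and then restricted to countable dense subsets. *)
theory Submission
  imports Defs
begin

text \<open>For each n some u in \<open>I\<close> keeps \<open>h u v\<close> below c + 1/(n+1) for
  all v at once. By compactness these points subconverge to some l in \<open>I\<close>, and for each
  fixed v the bound passes to l by continuity in u.\<close>

lemma INF_SUP_le_iff_compact:
  fixes h :: "'a::metric_space \<Rightarrow> 'b \<Rightarrow> real"
  assumes "compact I" and cont: "\<And>v. v \<in> J \<Longrightarrow> continuous_on I (\<lambda>u. h u v)"
  shows "(INF u\<in>I. SUP v\<in>J. ereal (h u v)) \<le> ereal c \<longleftrightarrow> (\<exists>u\<in>I. \<forall>v\<in>J. h u v \<le> c)"
proof
  assume le: "(INF u\<in>I. SUP v\<in>J. ereal (h u v)) \<le> ereal c"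
  \<comment> \<open>The slack makes the bound on the infimum strict, and a strict bound produces a
    witness u before attainment is known.\<close>
  have "\<exists>u\<in>I. \<forall>v\<in>J. h u v \<le> c + 1 / real (Suc n)" for n
  proof -
    have "ereal c < ereal (c + 1 / real (Suc n))"
      by simp
    then have "(INF u\<in>I. SUP v\<in>J. ereal (h u v)) < ereal (c + 1 / real (Suc n))"
      using le by (rule le_less_trans[rotated])
    then obtain u where "u \<in> I" "(SUP v\<in>J. ereal (h u v)) < ereal (c + 1 / real (Suc n))"
      by (auto simp only: INF_less_iff)
    then have "ereal (h u v) \<le> ereal (c + 1 / real (Suc n))" if "v \<in> J" for v
      using SUP_upper[OF that, of "\<lambda>v. ereal (h u v)"] by (meson less_imp_le order_trans)
    with \<open>u \<in> I\<close> show ?thesis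
      by auto
  qed
  then obtain x where x: "\<And>n. x n \<in> I" "\<And>n v. v \<in> J \<Longrightarrow> h (x n) v \<le> c + 1 / real (Suc n)"
    by metis
  obtain l r where l: "l \<in> I" "strict_mono (r :: nat \<Rightarrow> nat)" "(x \<circ> r) \<longlonglongrightarrow> l"
    using \<open>compact I\<close> x(1) unfolding compact_def by metis
  have "h l v \<le> c" if "v \<in> J" for v
  proof (rule LIMSEQ_le)
    show "(\<lambda>n. h ((x \<circ> r) n) v) \<longlonglongrightarrow> h l v"
      by (rule continuous_on_tendsto_compose[OF cont[OF that] l(3,1)]) (simp add: x(1))
    have "(\<lambda>n. c + 1 / real (Suc n)) \<longlonglongrightarrow> c + 0"
      by (intro tendsto_add tendsto_const LIMSEQ_Suc lim_1_over_n)
    from LIMSEQ_subseq_LIMSEQ[OF this l(2)]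
    show "(\<lambda>n. c + 1 / real (Suc (r n))) \<longlonglongrightarrow> c"
      by (simp add: o_def)
    show "\<exists>N. \<forall>n\<ge>N. h ((x \<circ> r) n) v \<le> c + 1 / real (Suc (r n))"
      using x(2)[OF that] by simp
  qed
  with \<open>l \<in> I\<close> show "\<exists>u\<in>I. \<forall>v\<in>J. h u v \<le> c"
    by blast
next
  assume "\<exists>u\<in>I. \<forall>v\<in>J. h u v \<le> c"
  then obtain u where "u \<in> I" "\<And>v. v \<in> J \<Longrightarrow> h u v \<le> c"
    by blast
  then show "(INF u\<in>I. SUP v\<in>J. ereal (h u v)) \<le> ereal c"
    by (intro INF_lower2[of u] SUP_least) auto
qed

text \<open>For countable \<open>C\<close> and \<open>D\<close> the right-hand side involves only
  countably many strict inequalities, the form needed for measurability. The slack 1/(n+1) is there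
  because the minimum of g over \<open>I\<close> need not be attained on \<open>C\<close>.\<close>

lemma ex_le_all_iff_dense:
  fixes g :: "'a::metric_space \<Rightarrow> real"
  assumes "compact I" "I \<noteq> {}" and contI: "continuous_on I g" and contJ: "continuous_on J g"
    and C: "C \<subseteq> I" "I \<subseteq> closure C" and D: "D \<subseteq> J" "J \<subseteq> closure D"
  shows "(\<exists>u\<in>I. \<forall>v\<in>J. g u \<le> g v) \<longleftrightarrow>
    (\<forall>v\<in>D. \<forall>n::nat. \<exists>u\<in>C. g u < g v + 1 / real (Suc n))"
proof
  assume "\<exists>u\<in>I. \<forall>v\<in>J. g u \<le> g v"
  then obtain u where u: "u \<in> I" "\<And>v. v \<in> J \<Longrightarrow> g u \<le> g v"
    by blast
  show "\<forall>v\<in>D. \<forall>n::nat. \<exists>u\<in>C. g u < g v + 1 / real (Suc n)"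
  proof (intro ballI allI)
    fix v and n :: nat
    assume "v \<in> D"
    obtain x where x: "\<And>k. x k \<in> C" "x \<longlonglongrightarrow> u"
      using u(1) C(2) closure_sequential by blast
    \<comment> \<open>The limit \<open>g u\<close> lies strictly below the bound, so
      \<open>g (x k)\<close> does too for large k.\<close>
    have "(\<lambda>k. g (x k)) \<longlonglongrightarrow> g u"
      using x(1) C(1) by (intro continuous_on_tendsto_compose[OF contI x(2) u(1)] always_eventually) auto
    moreover have "g u < g v + 1 / real (Suc n)"
      using u(2)[of v] \<open>v \<in> D\<close> D(1) by (intro le_less_trans[of "g u" "g v"]) auto
    ultimately have "\<forall>\<^sub>F k in sequentially. g (x k) < g v + 1 / real (Suc n)"
      by (rule order_tendstoD(2))
    then show "\<exists>u\<in>C. g u < g v + 1 / real (Suc n)"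
      using x(1) eventually_happens'[OF sequentially_bot] by blast
  qed
next
  assume dense: "\<forall>v\<in>D. \<forall>n::nat. \<exists>u\<in>C. g u < g v + 1 / real (Suc n)"
  \<comment> \<open>The point w supplied by \<open>dense\<close> depends on v and n; a minimiser u
    of g on \<open>I\<close> can replace all of them, since \<open>g u \<le> g w\<close>.\<close>
  obtain u where u: "u \<in> I" "\<And>w. w \<in> I \<Longrightarrow> g u \<le> g w"
    using continuous_attains_inf[OF \<open>compact I\<close> \<open>I \<noteq> {}\<close> contI] by blast
  have le_D: "g u \<le> g v" if v: "v \<in> D" for v
  proof (rule field_le_epsilon)
    fix e :: real
    assume "e > 0"
    then obtain n where "1 / real (Suc n) < e"
      using nat_approx_posE by blast
    moreover obtain w where "w \<in> C" "g w < g v + 1 / real (Suc n)"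
      using dense[rule_format, OF v, of n] by blast
    ultimately show "g u \<le> g v + e"
      using u(2)[of w] C(1) by auto
  qed
  have "g u \<le> g v" if v: "v \<in> J" for v
  proof -
    obtain y where y: "\<And>k. y k \<in> D" "y \<longlonglongrightarrow> v"
      using v D(2) closure_sequential by blast
    have "(\<lambda>k. g (y k)) \<longlonglongrightarrow> g v"
      using y(1) D(1) by (intro continuous_on_tendsto_compose[OF contJ y(2) v] always_eventually) auto
    then show ?thesis
      using le_D[OF y(1)] by (intro LIMSEQ_le_const) auto
  qed
  with u(1) show "\<exists>u\<in>I. \<forall>v\<in>J. g u \<le> g v"
    by blast
qed

text \<open>Subsets of a second countable metric space have countable dense subsets, so the event
  can be rewritten, path by path, through countable intersections and unions of measurable
  sets.\<close>

lemma sets_ex_le_all: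
  fixes g :: "'i::{metric_space, second_countable_topology} \<Rightarrow> 'a \<Rightarrow> real"
  assumes "compact I" "I \<noteq> {}"
    and meas: "\<And>u. u \<in> I \<union> J \<Longrightarrow> g u \<in> borel_measurable P"
    and contI: "\<And>\<omega>. \<omega> \<in> space P \<Longrightarrow> continuous_on I (\<lambda>u. g u \<omega>)"
    and contJ: "\<And>\<omega>. \<omega> \<in> space P \<Longrightarrow> continuous_on J (\<lambda>u. g u \<omega>)"
  shows "{\<omega> \<in> space P. \<exists>u\<in>I. \<forall>v\<in>J. g u \<omega> \<le> g v \<omega>} \<in> sets P"
proof -
  obtain C where C: "countable C" "C \<subseteq> I" "I \<subseteq> closure C"
    using separable by blast
  obtain D where D: "countable D" "D \<subseteq> J" "J \<subseteq> closure D"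
    using separable by blast
  have "{\<omega> \<in> space P. g u \<omega> < g v \<omega> + 1 / real (Suc n)} \<in> sets P"
    if "u \<in> C" "v \<in> D" for u v and n :: nat
    using meas[of u] meas[of v] that C(2) D(2)
    by (intro borel_measurable_less borel_measurable_add borel_measurable_const) auto
  then have "{\<omega> \<in> space P. \<forall>v\<in>D. \<forall>n::nat. \<exists>u\<in>C. g u \<omega> < g v \<omega> + 1 / real (Suc n)} \<in> sets P"
    using C(1) D(1)
    by (intro sets.sets_Collect_countable_All' sets.sets_Collect_countable_All
        sets.sets_Collect_countable_Ex')
  also have "{\<omega> \<in> space P. \<forall>v\<in>D. \<forall>n::nat. \<exists>u\<in>C. g u \<omega> < g v \<omega> + 1 / real (Suc n)} =
      {\<omega> \<in> space P. \<exists>u\<in>I. \<forall>v\<in>J. g u \<omega> \<le> g v \<omega>}"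
    using ex_le_all_iff_dense[OF assms(1,2) contI contJ C(2,3) D(2,3)]
    by (intro Collect_cong conj_cong refl) simp
  finally show ?thesis .
qed

text \<open>The infimum and supremum may range over uncountable sets, so measurability of both sets
  is part of the conclusion: it makes them events and gives the equality of probabilities its
  meaning.\<close>

theorem lemmaC3:
  fixes P :: "'a measure" and M :: real and F :: "real \<Rightarrow> 'a \<Rightarrow> real"
    and I J :: "real set" and t :: real
  assumes "prob_space P"
    and "M > 0"
    and "\<And>u. u \<in> {-M..M} \<Longrightarrow> F u \<in> borel_measurable P"
    and "\<And>\<omega>. \<omega> \<in> space P \<Longrightarrow> continuous_on {-M..M} (\<lambda>u. F u \<omega>)"
    and "I \<subseteq> {0..M}" and "I \<noteq> {}" and "compact I"
    and "J \<subseteq> {-M..<0}" and "J \<noteq> {}"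
  shows "{\<omega> \<in> space P. (INF u\<in>I. SUP v\<in>J. ereal ((F u \<omega> - F v \<omega>) / (u - v))) \<le> ereal t} \<in> sets P
    \<and> {\<omega> \<in> space P. (INF u\<in>I. SUP v\<in>J. ereal (F u \<omega> - F v \<omega> - t * (u - v))) \<le> 0} \<in> sets P
    \<and> {\<omega> \<in> space P. (INF u\<in>I. SUP v\<in>J. ereal ((F u \<omega> - F v \<omega>) / (u - v))) \<le> ereal t}
        = {\<omega> \<in> space P. (INF u\<in>I. SUP v\<in>J. ereal (F u \<omega> - F v \<omega> - t * (u - v))) \<le> 0}
    \<and> measure P {\<omega> \<in> space P. (INF u\<in>I. SUP v\<in>J. ereal ((F u \<omega> - F v \<omega>) / (u - v))) \<le> ereal t}
        = measure P {\<omega> \<in> space P. (INF u\<in>I. SUP v\<in>J. ereal (F u \<omega> - F v \<omega> - t * (u - v))) \<le> 0}"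
proof -
  let ?A = "{\<omega> \<in> space P. (INF u\<in>I. SUP v\<in>J. ereal ((F u \<omega> - F v \<omega>) / (u - v))) \<le> ereal t}"
  let ?B = "{\<omega> \<in> space P. (INF u\<in>I. SUP v\<in>J. ereal (F u \<omega> - F v \<omega> - t * (u - v))) \<le> 0}"
  let ?E = "{\<omega> \<in> space P. \<exists>u\<in>I. \<forall>v\<in>J. F u \<omega> - t * u \<le> F v \<omega> - t * v}"
  have I: "I \<subseteq> {-M..M}" and J: "J \<subseteq> {-M..M}"
    using \<open>M > 0\<close> \<open>I \<subseteq> {0..M}\<close> \<open>J \<subseteq> {-M..<0}\<close> by force+
  \<comment> \<open>As \<open>I\<close> may contain 0, it matters that \<open>J\<close> excludes it.
    Positivity serves twice: the quotient is continuous in u, and multiplying by u - v preserves the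
    inequality.\<close>
  have pos: "u - v > 0" if "u \<in> I" "v \<in> J" for u v
    using that \<open>I \<subseteq> {0..M}\<close> \<open>J \<subseteq> {-M..<0}\<close> by force
  have contI: "continuous_on I (\<lambda>u. F u \<omega>)" if "\<omega> \<in> space P" for \<omega>
    using assms(4)[OF that] I continuous_on_subset by blast
  have contJ: "continuous_on J (\<lambda>u. F u \<omega>)" if "\<omega> \<in> space P" for \<omega>
    using assms(4)[OF that] J continuous_on_subset by blast
  have "(INF u\<in>I. SUP v\<in>J. ereal ((F u \<omega> - F v \<omega>) / (u - v))) \<le> ereal t \<longleftrightarrow>
      (\<exists>u\<in>I. \<forall>v\<in>J. F u \<omega> - t * u \<le> F v \<omega> - t * v)" if "\<omega> \<in> space P" for \<omega>
  proof -
    have "(INF u\<in>I. SUP v\<in>J. ereal ((F u \<omega> - F v \<omega>) / (u - v))) \<le> ereal t \<longleftrightarrow>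
        (\<exists>u\<in>I. \<forall>v\<in>J. (F u \<omega> - F v \<omega>) / (u - v) \<le> t)"
      using pos by (intro INF_SUP_le_iff_compact \<open>compact I\<close>)
        (force intro!: continuous_intros contI[OF that])
    moreover have "(F u \<omega> - F v \<omega>) / (u - v) \<le> t \<longleftrightarrow> F u \<omega> - t * u \<le> F v \<omega> - t * v"
      if "u \<in> I" "v \<in> J" for u v
      using pos[OF that] by (simp add: divide_le_eq algebra_simps)
    ultimately show ?thesis
      by auto
  qed
  then have A: "?A = ?E"
    by blast
  have "(INF u\<in>I. SUP v\<in>J. ereal (F u \<omega> - F v \<omega> - t * (u - v))) \<le> 0 \<longleftrightarrow>
      (\<exists>u\<in>I. \<forall>v\<in>J. F u \<omega> - t * u \<le> F v \<omega> - t * v)" if "\<omega> \<in> space P" for \<omega>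
  proof -
    \<comment> \<open>The bound is written \<open>ereal 0\<close> to fit the real bound c of the
      compactness lemma; it is turned back into 0 at the end.\<close>
    have "(INF u\<in>I. SUP v\<in>J. ereal (F u \<omega> - F v \<omega> - t * (u - v))) \<le> ereal 0 \<longleftrightarrow>
        (\<exists>u\<in>I. \<forall>v\<in>J. F u \<omega> - F v \<omega> - t * (u - v) \<le> 0)"
      by (intro INF_SUP_le_iff_compact \<open>compact I\<close> continuous_intros contI[OF that])
    moreover have "F u \<omega> - F v \<omega> - t * (u - v) \<le> 0 \<longleftrightarrow> F u \<omega> - t * u \<le> F v \<omega> - t * v" for u v
      by (simp add: algebra_simps)
    ultimately show ?thesis
      by (simp flip: zero_ereal_def)
  qed
  then have B: "?B = ?E"
    by blast
  \<comment> \<open>For each path, subtracting the deterministic linear term t u preserves both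
    measurability and continuity.\<close>
  have "?E \<in> sets P"
    using I J
    by (intro sets_ex_le_all[where g = "\<lambda>u \<omega>. F u \<omega> - t * u"] \<open>compact I\<close> \<open>I \<noteq> {}\<close>)
      (auto intro!: borel_measurable_diff assms(3) continuous_intros contI contJ)
  with A B show ?thesis
    by simp
qed

end
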